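(* Every topologically virtually nilpotent, compactly generated, locally compact Hausdorff group has finite asymptotic dimension.
   Context: A subgroup $P$ of a topological group $G$ is cocompact if there is a compact subset $K\subseteq G$ with $G=KP$. $G$ is topologically virtually nilpotent (TVN) if it has a nilpotent cocompact subgroup. The asymptotic dimension $\mathrm{asdim}(G)$ of a second countable locally compact group is its (Gromov) asymptotic dimension with respect to any plig metric, i.e. a proper left-invariant metric generating the topology (any two are coarsely equivalent); for general locally compact $G$, $\mathrm{asdim}(G)$ is the supremum of $\mathrm{asdim}(K)$ over compactly generated closed subgroups $K\le G$, equivalently the asymptotic dimension of $G$ with its canonical left coarse structure, whose controlled sets are the $E\subseteq G\times G$ with $\{x^{-1}y:(x,y)\in E\}$ relatively compact. *)

theory Defs
  imports "HOL-Analysis.Analysis" "HOL-Algebra.Generated_Groups" "HOL-Library.Extended_Nat"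
begin

locale topological_group = group G for G :: "('a, 'b) monoid_scheme" (structure) +
  fixes T :: "'a topology"
  assumes topspace_eq_carrier: "topspace T = carrier G"
    and continuous_mult: "continuous_map (prod_topology T T) T (\<lambda>(x, y). x \<otimes> y)"
    and continuous_inv: "continuous_map T T (\<lambda>x. inv x)"

definition compactly_generated_group :: "('a, 'b) monoid_scheme \<Rightarrow> 'a topology \<Rightarrow> bool" where
  "compactly_generated_group G T \<longleftrightarrow> (\<exists>C. compactin T C \<and> generate G C = carrier G)"

primrec lower_central :: "('a, 'b) monoid_scheme \<Rightarrow> nat \<Rightarrow> 'a set" where
  "lower_central G 0 = carrier G"
| "lower_central G (Suc n) =
     generate G (\<Union>x \<in> lower_central G n. \<Union>y \<in> carrier G.
       {x \<otimes>\<^bsub>G\<^esub> y \<otimes>\<^bsub>G\<^esub> inv\<^bsub>G\<^esub> x \<otimes>\<^bsub>G\<^esub> inv\<^bsub>G\<^esub> y})"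

definition nilpotent_group :: "('a, 'b) monoid_scheme \<Rightarrow> bool" where
  "nilpotent_group G \<longleftrightarrow> group G \<and> (\<exists>n. lower_central G n = {\<one>\<^bsub>G\<^esub>})"

definition cocompact_subgroup :: "'a set \<Rightarrow> ('a, 'b) monoid_scheme \<Rightarrow> 'a topology \<Rightarrow> bool" where
  "cocompact_subgroup P G T \<longleftrightarrow>
     subgroup P G \<and> (\<exists>K. compactin T K \<and> carrier G = K <#>\<^bsub>G\<^esub> P)"

text \<open>The nilpotent cocompact subgroup is not required to be closed.\<close>

definition topologically_virtually_nilpotent ::
    "('a, 'b) monoid_scheme \<Rightarrow> 'a topology \<Rightarrow> bool" where
  "topologically_virtually_nilpotent G T \<longleftrightarrow>
     (\<exists>P. cocompact_subgroup P G T \<and> nilpotent_group (G\<lparr>carrier := P\<rparr>))"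

text \<open>Asymptotic dimension of a set \<open>X\<close> equipped with a coarse structure, given as the
  collection \<open>\<E>\<close> of its controlled sets. When \<open>\<E>\<close> comes from a metric, this is Gromov's
  definition: for every \<open>r\<close> there is a uniformly bounded cover of \<open>X\<close> that is a union of
  \<open>n + 1\<close> families, each of them \<open>r\<close>-disjoint. The dimension is \<open>\<infinity>\<close> (the infimum of the empty
  set) if there is no such \<open>n\<close>.\<close>

definition asdim_le :: "'a set \<Rightarrow> ('a \<times> 'a) set set \<Rightarrow> nat \<Rightarrow> bool" where
  "asdim_le X \<E> n \<longleftrightarrow>
     (\<forall>E \<in> \<E>. \<exists>\<U> :: nat \<Rightarrow> 'a set set.
        (\<Union>i\<le>n. \<Union>(\<U> i)) = X \<and>
        (\<forall>i\<le>n. \<forall>A \<in> \<U> i. \<forall>B \<in> \<U> i. A \<noteq> B \<longrightarrow> (A \<times> B) \<inter> E = {}) \<and>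
        (\<Union>i\<le>n. \<Union>A \<in> \<U> i. A \<times> A) \<in> \<E>)"

definition coarse_asdim :: "'a set \<Rightarrow> ('a \<times> 'a) set set \<Rightarrow> enat" where
  "coarse_asdim X \<E> = Inf {enat n | n. asdim_le X \<E> n}"

definition left_coarse_structure ::
    "('a, 'b) monoid_scheme \<Rightarrow> 'a topology \<Rightarrow> ('a \<times> 'a) set set" where
  "left_coarse_structure G T =
     {E. E \<subseteq> carrier G \<times> carrier G \<and>
         compactin T (T closure_of ((\<lambda>(x, y). inv\<^bsub>G\<^esub> x \<otimes>\<^bsub>G\<^esub> y) ` E))}"

text \<open>A compactly generated locally compact group need not be second countable, hence need
  not carry a proper left-invariant compatible metric, so the asymptotic dimension is taken with
  respect to the canonical left coarse structure.\<close>

definition asdim :: "('a, 'b) monoid_scheme \<Rightarrow> 'a topology \<Rightarrow> enat" where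
  "asdim G T = coarse_asdim (carrier G) (left_coarse_structure G T)"

end

theory Submission
  imports Defs "HOL-Library.Landau_Symbols"
begin

text \<open>Let \<open>P\<close> be a nilpotent cocompact subgroup. A large enough compact symmetric generating
  neighbourhood \<open>U\<close> of the identity defines a word metric on \<open>G\<close> that induces the left coarse
  structure. Compactness of \<open>U\<^sup>2\<close> gives a finite \<open>F \<subseteq> P\<close> with \<open>U\<^sup>2 \<subseteq> F U\<close>, hence
  \<open>U\<^sup>n \<subseteq> F\<^sup>n U\<close>, so a 2-separated subset of the \<open>n\<close>-ball has at most \<open>\<bar>F\<^sup>n\<bar>\<close> points. This is
  bounded by a polynomial in \<open>n\<close>, because \<open>P\<close> is nilpotent.

  Polynomial growth of the packing numbers \<open>q(n)\<close> forces \<open>q(10 k) \<le> D q(k)\<close>, with \<open>D\<close> fixed, for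
  arbitrarily large \<open>k\<close>. At such a scale put \<open>R = 3 k\<close> and take a maximal \<open>R\<close>-separated set. By
  homogeneity each of its points has at most \<open>D\<close> neighbours within \<open>3 R\<close>, as the \<open>k\<close>-balls around
  them contain disjoint packings that fit into a ball of radius \<open>10 k\<close>. So \<open>D + 1\<close> colours separate
  neighbours, and the \<open>R\<close>-balls sorted by the colour of their centre form the required cover.\<close>

section \<open>Asymptotic dimension of homogeneous metric spaces\<close>

lemma maximal_independent_set:
  assumes "symp R"
  obtains I where "I \<subseteq> X" "pairwise (\<lambda>x y. \<not> R x y) I" "\<And>x. x \<in> X - I \<Longrightarrow> \<exists>y\<in>I. R x y"
proof -
  let ?indep = "{I. I \<subseteq> X \<and> pairwise (\<lambda>x y. \<not> R x y) I}"
  have "\<exists>I\<in>?indep. \<forall>J\<in>?indep. I \<subseteq> J \<longrightarrow> J = I"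
  proof (rule subset_Zorn')
    fix \<C> assume chain: "subset.chain ?indep \<C>"
    have "pairwise (\<lambda>x y. \<not> R x y) (\<Union>\<C>)"
    proof (rule pairwiseI)
      fix x y assume "x \<in> \<Union>\<C>" "y \<in> \<Union>\<C>" "x \<noteq> y"
      then obtain I J where IJ: "I \<in> \<C>" "x \<in> I" "J \<in> \<C>" "y \<in> J" by blast
      then have "I \<subseteq> J \<or> J \<subseteq> I" "I \<in> ?indep" "J \<in> ?indep"
        using chain by (auto simp: subset_chain_def)
      with IJ \<open>x \<noteq> y\<close> show "\<not> R x y"
        by (auto simp: pairwise_def)
    qed
    then show "\<Union>\<C> \<in> ?indep"
      using chain by (auto simp: subset_chain_def)
  qed
  then obtain I where I: "I \<in> ?indep" and maximal: "\<forall>J\<in>?indep. I \<subseteq> J \<longrightarrow> J = I"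
    by (rule bexE)
  have "\<exists>y\<in>I. R x y" if "x \<in> X - I" for x
  proof (rule ccontr)
    assume "\<not> (\<exists>y\<in>I. R x y)"
    then have "insert x I \<in> ?indep"
      using I that assms by (auto simp: pairwise_insert dest: sympD)
    then show False
      using maximal that by blast
  qed
  with I show ?thesis
    using that[of I] by simp
qed

definition proper_colouring :: "('a \<Rightarrow> 'a \<Rightarrow> bool) \<Rightarrow> 'a set \<Rightarrow> nat \<Rightarrow> ('a \<Rightarrow> nat) \<Rightarrow> bool" where
  "proper_colouring R X D col \<longleftrightarrow>
    col \<in> X \<rightarrow> {..D} \<and> (\<forall>x\<in>X. \<forall>y\<in>X. x \<noteq> y \<and> col x = col y \<longrightarrow> \<not> R x y)"

lemma proper_colouring_new_colour:
  assumes "pairwise (\<lambda>x y. \<not> R x y) I" "proper_colouring R (X - I) D col"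
  shows "proper_colouring R X (Suc D) (\<lambda>x. if x \<in> I then Suc D else col x)"
  unfolding proper_colouring_def
proof (intro conjI ballI impI)
  have range: "col x \<le> D" if "x \<in> X - I" for x
    using assms(2) that by (auto simp: proper_colouring_def)
  then show "(\<lambda>x. if x \<in> I then Suc D else col x) \<in> X \<rightarrow> {..Suc D}"
    by (simp add: Pi_iff le_SucI)
  fix x y assume xy: "x \<in> X" "y \<in> X" "x \<noteq> y \<and>
    (if x \<in> I then Suc D else col x) = (if y \<in> I then Suc D else col y)"
  then have "x \<in> I \<longleftrightarrow> y \<in> I"
    using range[of x] range[of y] by (auto split: if_splits)
  then show "\<not> R x y"
    using assms xy by (auto simp: pairwise_def proper_colouring_def split: if_splits)
qed

text \<open>Give a maximal independent set a new colour: every other vertex loses a neighbour. This also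
  works for infinite graphs.\<close>

lemma bounded_degree_colouring:
  assumes "symp R" "\<And>x. x \<in> X \<Longrightarrow> finite {y \<in> X. y \<noteq> x \<and> R x y}"
    and "\<And>x. x \<in> X \<Longrightarrow> card {y \<in> X. y \<noteq> x \<and> R x y} \<le> D"
  shows "\<exists>col. proper_colouring R X D col"
  using assms(2,3)
proof (induction D arbitrary: X)
  case 0
  have "{y \<in> X. y \<noteq> x \<and> R x y} = {}" if "x \<in> X" for x
    using 0(1)[OF that] 0(2)[OF that] by (simp only: le_zero_eq card_0_eq)
  then show ?case
    by (intro exI[of _ "\<lambda>_. 0"]) (auto simp: proper_colouring_def)
next
  case (Suc D)
  obtain I where I: "I \<subseteq> X" "pairwise (\<lambda>x y. \<not> R x y) I" "\<And>x. x \<in> X - I \<Longrightarrow> \<exists>y\<in>I. R x y"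
    using maximal_independent_set[OF assms(1)] by blast
  have fewer: "{y \<in> X - I. y \<noteq> x \<and> R x y} \<subset> {y \<in> X. y \<noteq> x \<and> R x y}" if "x \<in> X - I" for x
    using I(1) I(3)[OF that] that by blast
  have "\<exists>col. proper_colouring R (X - I) D col"
  proof (rule Suc.IH)
    fix x assume x: "x \<in> X - I"
    show "finite {y \<in> X - I. y \<noteq> x \<and> R x y}"
      using Suc.prems(1)[of x] fewer[OF x] x by (auto intro: finite_subset)
    have "card {y \<in> X - I. y \<noteq> x \<and> R x y} < card {y \<in> X. y \<noteq> x \<and> R x y}"
      using Suc.prems(1) x by (intro psubset_card_mono fewer) auto
    then show "card {y \<in> X - I. y \<noteq> x \<and> R x y} \<le> D"
      using Suc.prems(2)[of x] x by simp
  qed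
  then show ?case
    using proper_colouring_new_colour[OF I(2)] by blast
qed

lemma polynomial_growth_imp_doubling:
  fixes p :: "nat \<Rightarrow> nat"
  assumes "(\<lambda>n. real (p n)) \<in> O(\<lambda>n. real n ^ m)" "\<And>n. 1 \<le> p n" "2 \<le> b"
  shows "\<exists>k\<ge>r. p (b * k) \<le> b ^ Suc m * p k"
proof (rule ccontr)
  assume no_scale: "\<not> ?thesis"
  obtain c where c: "\<forall>\<^sub>F n in sequentially. norm (real (p n)) \<le> c * norm (real n ^ m)"
    using assms(1) by (rule landau_o.bigE)
  then obtain n0 where upper: "\<And>n. n0 \<le> n \<Longrightarrow> real (p n) \<le> c * real n ^ m"
    unfolding eventually_sequentially by auto
  define k where "k = max 1 (max r n0)"
  have k_le: "k \<le> b ^ j * k" for j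
    using assms(3) by simp
  have lower: "(b ^ Suc m) ^ j \<le> p (b ^ j * k)" for j
  proof (induction j)
    case 0
    then show ?case using assms(2) by simp
  next
    case (Suc j)
    have "(b ^ Suc m) ^ Suc j \<le> b ^ Suc m * p (b ^ j * k)"
      using Suc by simp
    also have "\<dots> \<le> p (b * (b ^ j * k))"
      using no_scale k_le[of j] unfolding k_def by (meson max.bounded_iff nle_le)
    finally show ?case by (simp add: mult.assoc)
  qed
  obtain j where j: "c * real k ^ m < real b ^ j"
    using real_arch_pow[of "real b"] assms(3) by auto
  have "real b ^ j * (real b ^ m) ^ j = real ((b ^ Suc m) ^ j)"
    by (simp add: power_mult_distrib)
  also have "\<dots> \<le> real (p (b ^ j * k))"
    using lower by (simp only: of_nat_le_iff)
  also have "\<dots> \<le> c * real (b ^ j * k) ^ m"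
    using k_le[of j] by (intro upper) (simp add: k_def)
  also have "\<dots> = (c * real k ^ m) * (real b ^ m) ^ j"
    by (simp add: power_mult_distrib power_commutes power_mult[symmetric] mult.commute)
  finally show False
    using j assms(3) by simp
qed

context Metric_space
begin

definition bounded_coarse_structure :: "('a \<times> 'a) set set" where
  "bounded_coarse_structure = {E. E \<subseteq> M \<times> M \<and> (\<exists>r. \<forall>(x, y)\<in>E. d x y \<le> r)}"

definition packings :: "real \<Rightarrow> 'a set \<Rightarrow> 'a set set" where
  "packings e S = {Q. Q \<subseteq> S \<and> finite Q \<and> pairwise (\<lambda>x y. e < d x y) Q}"

lemma mdist_centres_le:
  assumes "u \<in> mcball x r" "v \<in> mcball y r"
  shows "d x y \<le> 2 * r + d u v"
proof -
  have "d x y \<le> d x u + d u v + d v y"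
    using triangle[of x v y] triangle[of x u v] assms by auto
  also have "\<dots> \<le> r + d u v + r"
    using assms by (intro add_mono) (auto simp: commute)
  finally show ?thesis by simp
qed

lemma coloured_net_exists:
  assumes "0 \<le> R"
    and "\<And>x N. x \<in> M \<Longrightarrow> N \<in> packings R (mcball x (3 * R)) \<Longrightarrow> card N \<le> D"
  obtains X col where "(\<Union>x\<in>X. mcball x R) = M" "proper_colouring (\<lambda>x y. d x y \<le> 3 * R) X D col"
proof -
  have symp_le: "symp (\<lambda>x y. d x y \<le> r)" for r
    by (simp add: symp_def commute)
  obtain X where X: "X \<subseteq> M" "pairwise (\<lambda>x y. \<not> d x y \<le> R) X"
    and maximal: "\<And>x. x \<in> M - X \<Longrightarrow> \<exists>y\<in>X. d x y \<le> R"
    using maximal_independent_set[OF symp_le] by blast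
  have "M \<subseteq> (\<Union>x\<in>X. mcball x R)"
  proof
    fix y assume "y \<in> M"
    then show "y \<in> (\<Union>x\<in>X. mcball x R)"
      using X(1) maximal[of y] assms(1) by (cases "y \<in> X") (auto simp: commute)
  qed
  then have cover: "(\<Union>x\<in>X. mcball x R) = M"
    using mcball_subset_mspace by (intro equalityI UN_least)
  have degree: "finite {y \<in> X. y \<noteq> x \<and> d x y \<le> 3 * R} \<and> card {y \<in> X. y \<noteq> x \<and> d x y \<le> 3 * R} \<le> D"
    if "x \<in> X" for x
  proof (rule finite_if_finite_subsets_card_bdd)
    fix N assume N: "N \<subseteq> {y \<in> X. y \<noteq> x \<and> d x y \<le> 3 * R}" "finite N"
    have "N \<subseteq> mcball x (3 * R)"
      using N(1) X(1) that by force
    moreover have "pairwise (\<lambda>y z. R < d y z) N"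
      using N(1) pairwise_subset[OF X(2), of N] by (auto simp: not_le)
    ultimately show "card N \<le> D"
      using X(1) N(2) that by (intro assms(2)[of x]) (auto simp: packings_def)
  qed
  then obtain col where "proper_colouring (\<lambda>x y. d x y \<le> 3 * R) X D col"
    using bounded_degree_colouring[OF symp_le, of X "3 * R" D] by blast
  with cover show ?thesis by (rule that)
qed

lemma same_colour_mcballs_far:
  assumes "proper_colouring (\<lambda>x y. d x y \<le> 3 * R) X D col" "x \<in> X" "y \<in> X" "col x = col y"
    and "mcball x R \<noteq> mcball y R" "a \<in> mcball x R" "b \<in> mcball y R"
  shows "R < d a b"
proof -
  have "x \<noteq> y"
    using assms(5) by metis
  then have "3 * R < d x y"
    using assms(1-4) by (simp add: proper_colouring_def not_le)
  also have "\<dots> \<le> 2 * R + d a b"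
    by (rule mdist_centres_le[OF assms(6,7)])
  finally show ?thesis by simp
qed

lemma UN_mcball_squares_bounded:
  assumes "\<And>i A. A \<in> \<U> i \<Longrightarrow> \<exists>x. A = mcball x R"
  shows "(\<Union>i\<in>I. \<Union>A\<in>\<U> i. A \<times> A) \<in> bounded_coarse_structure"
proof -
  have "y \<in> M \<and> z \<in> M \<and> d y z \<le> 2 * R" if A: "A \<in> \<U> i" "y \<in> A" "z \<in> A" for i A y z
  proof -
    obtain x where "A = mcball x R"
      using assms A(1) by blast
    then show ?thesis
      using A(2,3) triangle''[of y x z] by simp
  qed
  then have "\<forall>(y, z)\<in>(\<Union>i\<in>I. \<Union>A\<in>\<U> i. A \<times> A). d y z \<le> 2 * R"
    "(\<Union>i\<in>I. \<Union>A\<in>\<U> i. A \<times> A) \<subseteq> M \<times> M"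
    by blast+
  then show ?thesis
    unfolding bounded_coarse_structure_def by blast
qed

lemma asdim_le_of_local_packing_bound:
  assumes "\<And>r. \<exists>R\<ge>r. \<forall>x\<in>M. \<forall>N\<in>packings R (mcball x (3 * R)). card N \<le> D"
  shows "asdim_le M bounded_coarse_structure D"
  unfolding asdim_le_def
proof
  fix E assume "E \<in> bounded_coarse_structure"
  then obtain r where r: "\<And>x y. (x, y) \<in> E \<Longrightarrow> d x y \<le> r"
    unfolding bounded_coarse_structure_def by blast
  obtain R where R: "0 \<le> R" "r \<le> R"
    and bound: "\<And>x N. x \<in> M \<Longrightarrow> N \<in> packings R (mcball x (3 * R)) \<Longrightarrow> card N \<le> D"
    using assms[of "max 0 r"] by auto
  obtain X col where X: "(\<Union>x\<in>X. mcball x R) = M"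
    and col: "proper_colouring (\<lambda>x y. d x y \<le> 3 * R) X D col"
    by (rule coloured_net_exists[OF R(1) bound])
  define \<U> where "\<U> i = {mcball x R | x. x \<in> X \<and> col x = i}" for i
  have "(\<Union>i\<le>D. \<Union>(\<U> i)) = (\<Union>x\<in>X. mcball x R)"
    using col by (auto simp: \<U>_def proper_colouring_def Pi_iff)
  then have cover: "(\<Union>i\<le>D. \<Union>(\<U> i)) = M"
    using X by simp
  have disjoint: "A \<times> B \<inter> E = {}" if AB: "A \<in> \<U> i" "B \<in> \<U> i" "A \<noteq> B" for i A B
  proof -
    obtain x where x: "x \<in> X" "A = mcball x R" "col x = i"
      using AB(1) by (auto simp: \<U>_def)
    obtain y where y: "y \<in> X" "B = mcball y R" "col y = i"
      using AB(2) by (auto simp: \<U>_def)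
    have "R < d a b" if "a \<in> A" "b \<in> B" for a b
      using same_colour_mcballs_far[OF col x(1) y(1)] AB(3) that x(2,3) y(2,3) by simp
    then show ?thesis
      using r R(2) by fastforce
  qed
  have "\<exists>x. A = mcball x R" if "A \<in> \<U> i" for i A
    using that by (auto simp: \<U>_def)
  then have "(\<Union>i\<le>D. \<Union>A\<in>\<U> i. A \<times> A) \<in> bounded_coarse_structure"
    by (rule UN_mcball_squares_bounded)
  with cover disjoint show "\<exists>\<U> :: nat \<Rightarrow> 'a set set. (\<Union>i\<le>D. \<Union>(\<U> i)) = M \<and>
      (\<forall>i\<le>D. \<forall>A\<in>\<U> i. \<forall>B\<in>\<U> i. A \<noteq> B \<longrightarrow> A \<times> B \<inter> E = {}) \<and>
      (\<Union>i\<le>D. \<Union>A\<in>\<U> i. A \<times> A) \<in> bounded_coarse_structure"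
    by (intro exI[of _ \<U>] conjI allI impI ballI)
qed

text \<open>Junk unless the packings of \<open>S\<close> have bounded size.\<close>

definition packing_number :: "real \<Rightarrow> 'a set \<Rightarrow> nat" where
  "packing_number e S = Max (card ` packings e S)"

definition homogeneous :: bool where
  "homogeneous \<longleftrightarrow>
    (\<forall>x\<in>M. \<forall>y\<in>M. \<exists>f\<in>M \<rightarrow> M. (\<forall>u\<in>M. \<forall>v\<in>M. d (f u) (f v) = d u v) \<and> f x = y)"

lemma packing_number_attained:
  assumes "finite (card ` packings e S)"
  obtains Q where "Q \<in> packings e S" "card Q = packing_number e S"
proof -
  have "{} \<in> packings e S" by (simp add: packings_def)
  then have "packing_number e S \<in> card ` packings e S"
    unfolding packing_number_def using assms by (intro Max_in) auto
  then show ?thesis using that by auto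
qed

lemma card_le_packing_number:
  "finite (card ` packings e S) \<Longrightarrow> Q \<in> packings e S \<Longrightarrow> card Q \<le> packing_number e S"
  by (simp add: packing_number_def)

lemma card_packings_mcball_homogeneous:
  assumes "homogeneous" "x \<in> M" "y \<in> M"
  shows "card ` packings e (mcball x r) = card ` packings e (mcball y r)"
proof -
  have "card ` packings e (mcball x r) \<subseteq> card ` packings e (mcball y r)"
    if xy: "x \<in> M" "y \<in> M" for x y
  proof (rule image_subsetI)
    fix Q assume "Q \<in> packings e (mcball x r)"
    then have Q: "Q \<subseteq> mcball x r" "finite Q" "pairwise (\<lambda>u v. e < d u v) Q"
      by (auto simp: packings_def)
    obtain f where f: "f \<in> M \<rightarrow> M" "\<forall>u\<in>M. \<forall>v\<in>M. d (f u) (f v) = d u v" "f x = y"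
      using assms(1) xy unfolding homogeneous_def by blast
    have "inj_on f M"
      using f by (metis (no_types, lifting) inj_onI zero)
    then have "inj_on f Q"
      by (rule inj_on_subset) (use Q(1) in auto)
    then have "card Q = card (f ` Q)"
      by (rule card_image[symmetric])
    moreover have "f ` Q \<in> packings e (mcball y r)"
      unfolding packings_def
    proof (intro CollectI conjI)
      show "f ` Q \<subseteq> mcball y r"
        using Q(1) f(1,2) xy by (auto simp: subset_iff simp flip: f(3))
      show "pairwise (\<lambda>u v. e < d u v) (f ` Q)"
        using Q(1,3) f(2) by (intro pairwise_imageI) (auto simp: pairwise_def subset_iff)
    qed (use Q(2) in simp)
    ultimately show "card Q \<in> card ` packings e (mcball y r)"
      by (rule image_eqI)
  qed
  then show ?thesis
    using assms(2,3) by blast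
qed

lemma packings_far_apart:
  assumes "N \<in> packings (2 * r + e) S" "y \<in> N" "z \<in> N" "y \<noteq> z" "u \<in> mcball y r" "v \<in> mcball z r"
  shows "e < d u v"
proof -
  have "2 * r + e < d y z"
    using assms(1-4) by (auto simp: packings_def pairwise_def)
  also have "\<dots> \<le> 2 * r + d u v"
    by (rule mdist_centres_le[OF assms(5,6)])
  finally show ?thesis by simp
qed

lemma packings_UN:
  assumes "N \<in> packings (2 * r + e) (mcball x R)" "0 \<le> e"
    and "\<And>y. y \<in> N \<Longrightarrow> Q y \<in> packings e (mcball y r)"
  shows "(\<Union>y\<in>N. Q y) \<in> packings e (mcball x (R + r))" "card (\<Union>y\<in>N. Q y) = (\<Sum>y\<in>N. card (Q y))"
proof -
  have N: "N \<subseteq> mcball x R" "finite N"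
    using assms(1) by (auto simp: packings_def)
  have Q: "Q y \<subseteq> mcball y r" "finite (Q y)" "pairwise (\<lambda>u v. e < d u v) (Q y)" if "y \<in> N" for y
    using assms(3)[OF that] by (auto simp: packings_def)
  have far: "e < d u v" if "y \<in> N" "z \<in> N" "y \<noteq> z" "u \<in> Q y" "v \<in> Q z" for y z u v
    using packings_far_apart[OF assms(1) that(1-3)] Q(1) that by blast
  have "pairwise (\<lambda>u v. e < d u v) (\<Union>y\<in>N. Q y)"
  proof (rule pairwiseI)
    fix u v assume "u \<in> (\<Union>y\<in>N. Q y)" "v \<in> (\<Union>y\<in>N. Q y)" "u \<noteq> v"
    then show "e < d u v"
      using far Q(3) by (metis UN_E pairwiseD)
  qed
  moreover have "Q y \<subseteq> mcball x (R + r)" if "y \<in> N" for y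
  proof -
    have "d y x + r \<le> R + r" "x \<in> M"
      using N(1) that by (auto simp: commute)
    then show ?thesis
      using Q(1)[OF that] mcball_subset by blast
  qed
  ultimately show "(\<Union>y\<in>N. Q y) \<in> packings e (mcball x (R + r))"
    using N(2) Q(2) by (auto simp: packings_def)
  have "Q y \<inter> Q z = {}" if "y \<in> N" "z \<in> N" "y \<noteq> z" for y z
  proof (rule ccontr)
    assume "Q y \<inter> Q z \<noteq> {}"
    then obtain u where u: "u \<in> Q y" "u \<in> Q z" by blast
    then have "e < d u u" "u \<in> M"
      using far[of y z u u] Q(1)[of y] that by auto
    then show False
      using assms(2) by simp
  qed
  then show "card (\<Union>y\<in>N. Q y) = (\<Sum>y\<in>N. card (Q y))"
    using N(2) Q(2) by (intro card_UN_disjoint) auto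
qed

lemma card_times_packing_number_le:
  assumes "homogeneous" "x \<in> M" "0 \<le> e" "N \<in> packings (2 * r + e) (mcball x R)"
    and "finite (card ` packings e (mcball x r))" "finite (card ` packings e (mcball x (R + r)))"
  shows "card N * packing_number e (mcball x r) \<le> packing_number e (mcball x (R + r))"
proof -
  have "\<exists>Q\<in>packings e (mcball y r). card Q = packing_number e (mcball x r)" if "y \<in> N" for y
  proof -
    have "y \<in> M" using that assms(4) by (auto simp: packings_def)
    then have "card ` packings e (mcball x r) = card ` packings e (mcball y r)"
      by (rule card_packings_mcball_homogeneous[OF assms(1,2)])
    then show ?thesis
      using packing_number_attained[of e "mcball y r"] assms(5)
      by (metis packing_number_def)
  qed
  then obtain Q where Q: "\<And>y. y \<in> N \<Longrightarrow> Q y \<in> packings e (mcball y r)"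
    "\<And>y. y \<in> N \<Longrightarrow> card (Q y) = packing_number e (mcball x r)"
    by metis
  have "card N * packing_number e (mcball x r) = card (\<Union>y\<in>N. Q y)"
    using packings_UN(2)[OF assms(4,3) Q(1)] Q(2) by simp
  also have "\<dots> \<le> packing_number e (mcball x (R + r))"
    by (intro card_le_packing_number assms(6) packings_UN(1)[OF assms(4,3) Q(1)])
  finally show ?thesis .
qed

lemma card_packing_le_of_doubling:
  assumes "homogeneous" "x\<^sub>0 \<in> M" "x \<in> M" "0 \<le> e" "e \<le> r"
    and bounded: "\<And>\<rho>. finite (card ` packings e (mcball x\<^sub>0 \<rho>))"
    and doubling: "packing_number e (mcball x\<^sub>0 (10 * r)) \<le> D * packing_number e (mcball x\<^sub>0 r)"
    and "N \<in> packings (3 * r) (mcball x (9 * r))"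
  shows "card N \<le> D"
proof -
  have same_cards: "card ` packings e (mcball x \<rho>) = card ` packings e (mcball x\<^sub>0 \<rho>)" for \<rho>
    by (rule card_packings_mcball_homogeneous[OF assms(1,3,2)])
  have "N \<in> packings (2 * r + e) (mcball x (9 * r))"
    using assms(5,8) by (force simp: packings_def pairwise_def)
  moreover have "9 * r + r = 10 * r" by simp
  ultimately have "card N * packing_number e (mcball x r) \<le> packing_number e (mcball x (10 * r))"
    using card_times_packing_number_le[OF assms(1,3,4)] bounded same_cards by metis
  also have "\<dots> \<le> D * packing_number e (mcball x r)"
    using doubling by (simp add: packing_number_def same_cards)
  finally have "card N * packing_number e (mcball x r) \<le> D * packing_number e (mcball x r)" .
  moreover have "{x} \<in> packings e (mcball x r)"
    using assms(3-5) by (simp add: packings_def)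
  then have "card {x} \<le> packing_number e (mcball x r)"
    using bounded same_cards by (intro card_le_packing_number) simp_all
  ultimately show ?thesis by simp
qed

lemma finite_card_packings_mcball:
  assumes "\<And>n Q. Q \<in> packings e (mcball x (real n)) \<Longrightarrow> card Q \<le> p n"
  shows "finite (card ` packings e (mcball x r))"
proof -
  have "packings e (mcball x r) \<subseteq> packings e (mcball x (real (nat \<lceil>r\<rceil>)))"
    using mcball_subset_concentric[OF real_nat_ceiling_ge[of r], of x] by (auto simp: packings_def)
  then have "card ` packings e (mcball x r) \<subseteq> {..p (nat \<lceil>r\<rceil>)}"
    using assms by blast
  then show ?thesis
    by (rule finite_subset) simp
qed

theorem asdim_le_of_polynomial_packing:
  fixes p :: "nat \<Rightarrow> nat"
  assumes "homogeneous" "x\<^sub>0 \<in> M" "0 \<le> e"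
    and packing_le: "\<And>n Q. Q \<in> packings e (mcball x\<^sub>0 (real n)) \<Longrightarrow> card Q \<le> p n"
    and growth: "(\<lambda>n. real (p n)) \<in> O(\<lambda>n. real n ^ m)"
  shows "asdim_le M bounded_coarse_structure (10 ^ Suc m)"
proof (rule asdim_le_of_local_packing_bound)
  fix r :: real
  define q where "q n = packing_number e (mcball x\<^sub>0 (real n))" for n
  have bounded: "finite (card ` packings e (mcball x\<^sub>0 \<rho>))" for \<rho>
    by (rule finite_card_packings_mcball[OF packing_le])
  have q_pos: "1 \<le> q n" for n
    using card_le_packing_number[OF bounded, of "{x\<^sub>0}"] assms(2)
    by (simp add: q_def packings_def)
  have "q n \<le> p n" for n
    using packing_number_attained[OF bounded, of n] packing_le by (metis q_def)
  then have "(\<lambda>n. real (q n)) \<in> O(\<lambda>n. real n ^ m)"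
    by (intro landau_o.big.trans[OF bigoI[of _ 1] growth]) simp
  then obtain k where k: "nat \<lceil>max r e\<rceil> \<le> k" "q (10 * k) \<le> 10 ^ Suc m * q k"
    using polynomial_growth_imp_doubling[of q m 10 "nat \<lceil>max r e\<rceil>", OF _ q_pos]
    by (auto simp del: power_Suc)
  then have k_ge: "r \<le> real k" "e \<le> real k"
    by linarith+
  have "card N \<le> 10 ^ Suc m"
    if "x \<in> M" "N \<in> packings (3 * real k) (mcball x (3 * (3 * real k)))" for x N
    using that k(2) by (intro card_packing_le_of_doubling[OF assms(1,2) _ assms(3) k_ge(2) bounded])
      (simp_all add: q_def)
  moreover have "r \<le> 3 * real k"
    using k_ge by simp
  ultimately show "\<exists>R\<ge>r. \<forall>x\<in>M. \<forall>N\<in>packings R (mcball x (3 * R)). card N \<le> 10 ^ Suc m"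
    by blast
qed

end

section \<open>Word metrics\<close>

definition list_prod :: "('a, 'b) monoid_scheme \<Rightarrow> 'a list \<Rightarrow> 'a" where
  "list_prod G xs = foldr (\<otimes>\<^bsub>G\<^esub>) xs \<one>\<^bsub>G\<^esub>"

definition word_ball :: "('a, 'b) monoid_scheme \<Rightarrow> 'a set \<Rightarrow> nat \<Rightarrow> 'a set" where
  "word_ball G A n = {list_prod G xs | xs. set xs \<subseteq> A \<and> length xs \<le> n}"

lemma list_prod_simps [simp]:
  "list_prod G [] = \<one>\<^bsub>G\<^esub>"
  "list_prod G (x # xs) = x \<otimes>\<^bsub>G\<^esub> list_prod G xs"
  by (simp_all add: list_prod_def)

lemma word_ball_consistent [simp]: "word_ball (G\<lparr>carrier := H\<rparr>) A n = word_ball G A n"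
  by (simp add: word_ball_def list_prod_def)

lemma word_ballI: "set xs \<subseteq> A \<Longrightarrow> length xs \<le> n \<Longrightarrow> list_prod G xs \<in> word_ball G A n"
  unfolding word_ball_def by blast

lemma word_ballE:
  assumes "x \<in> word_ball G A n"
  obtains xs where "set xs \<subseteq> A" "length xs \<le> n" "x = list_prod G xs"
  using assms unfolding word_ball_def by blast

lemma word_ball_mono: "m \<le> n \<Longrightarrow> A \<subseteq> B \<Longrightarrow> word_ball G A m \<subseteq> word_ball G B n"
  unfolding word_ball_def by force

lemma word_ball_0 [simp]: "word_ball G A 0 = {\<one>\<^bsub>G\<^esub>}"
  by (auto simp: word_ball_def)

lemma word_ball_empty [simp]: "word_ball G {} n = {\<one>\<^bsub>G\<^esub>}"
  by (auto simp: word_ball_def)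

lemma one_in_word_ball [simp]: "\<one>\<^bsub>G\<^esub> \<in> word_ball G A n"
  using word_ballI[of "[]" A n G] by simp

lemma finite_word_ball:
  assumes "finite A"
  shows "finite (word_ball G A n)"
proof -
  have "word_ball G A n = list_prod G ` {xs. set xs \<subseteq> A \<and> length xs \<le> n}"
    by (auto simp: word_ball_def)
  then show ?thesis
    using finite_lists_length_le[OF assms] by simp
qed

lemma (in monoid) subset_set_mult_right:
  assumes "A \<subseteq> carrier G" "\<one> \<in> B"
  shows "A \<subseteq> A <#> B"
proof
  fix a assume "a \<in> A"
  then have "a \<otimes> \<one> \<in> A <#> B"
    using assms(2) unfolding set_mult_def by blast
  then show "a \<in> A <#> B"
    using \<open>a \<in> A\<close> assms(1) by (simp add: subset_iff)
qed

context group
begin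

lemma inv_mult_cancel [simp]: "x \<in> carrier G \<Longrightarrow> y \<in> carrier G \<Longrightarrow> inv x \<otimes> (x \<otimes> y) = y"
  by (simp flip: m_assoc)

lemma mult_inv_cancel [simp]: "x \<in> carrier G \<Longrightarrow> y \<in> carrier G \<Longrightarrow> x \<otimes> (inv x \<otimes> y) = y"
  by (simp flip: m_assoc)

lemma list_prod_closed [simp]: "set xs \<subseteq> carrier G \<Longrightarrow> list_prod G xs \<in> carrier G"
  by (induction xs) auto

lemma list_prod_append:
  "set xs \<subseteq> carrier G \<Longrightarrow> set ys \<subseteq> carrier G \<Longrightarrow>
    list_prod G (xs @ ys) = list_prod G xs \<otimes> list_prod G ys"
  by (induction xs) (auto simp: m_assoc)

lemma list_prod_filter_one:
  "set xs \<subseteq> carrier G \<Longrightarrow> list_prod G (filter (\<lambda>x. x \<noteq> \<one>) xs) = list_prod G xs"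
  by (induction xs) auto

lemma word_ball_subset_carrier: "A \<subseteq> carrier G \<Longrightarrow> word_ball G A n \<subseteq> carrier G"
  unfolding word_ball_def by auto

lemma subset_word_ball:
  assumes "A \<subseteq> carrier G"
  shows "A \<subseteq> word_ball G A 1"
proof
  fix x assume "x \<in> A"
  then show "x \<in> word_ball G A 1"
    using assms word_ballI[of "[x]" A 1 G] by auto
qed

lemma word_ball_mult:
  assumes "A \<subseteq> carrier G" "x \<in> word_ball G A m" "y \<in> word_ball G A n"
  shows "x \<otimes> y \<in> word_ball G A (m + n)"
proof -
  obtain xs where xs: "set xs \<subseteq> A" "length xs \<le> m" "x = list_prod G xs"
    using assms(2) by (rule word_ballE)
  obtain ys where ys: "set ys \<subseteq> A" "length ys \<le> n" "y = list_prod G ys"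
    using assms(3) by (rule word_ballE)
  have "x \<otimes> y = list_prod G (xs @ ys)"
    using xs ys assms(1) by (subst list_prod_append) auto
  then show ?thesis
    using xs ys word_ballI[of "xs @ ys" A "m + n" G] by auto
qed

lemma word_ball_Suc:
  assumes "A \<subseteq> carrier G"
  shows "word_ball G A (Suc n) = insert \<one> (word_ball G A n <#> A)"
proof (intro equalityI subsetI)
  fix x assume "x \<in> word_ball G A (Suc n)"
  then obtain xs where xs: "set xs \<subseteq> A" "length xs \<le> Suc n" "x = list_prod G xs"
    by (rule word_ballE)
  show "x \<in> insert \<one> (word_ball G A n <#> A)"
  proof (cases xs rule: rev_cases)
    case Nil
    then show ?thesis using xs by simp
  next
    case (snoc ys a)
    then have "set ys \<subseteq> carrier G" "a \<in> carrier G"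
      using xs(1) assms by auto
    then have "x = list_prod G ys \<otimes> a"
      using xs(3) snoc by (simp add: list_prod_append)
    moreover have "list_prod G ys \<in> word_ball G A n" "a \<in> A"
      using xs snoc by (auto intro: word_ballI)
    ultimately show ?thesis
      unfolding set_mult_def by blast
  qed
next
  fix x assume "x \<in> insert \<one> (word_ball G A n <#> A)"
  then show "x \<in> word_ball G A (Suc n)"
    using word_ball_mult[OF assms, of _ n _ 1] subset_word_ball[OF assms]
    by (auto simp: set_mult_def)
qed

lemma word_ball_inv:
  assumes "A \<subseteq> carrier G" "\<And>a. a \<in> A \<Longrightarrow> inv a \<in> A" "x \<in> word_ball G A n"
  shows "inv x \<in> word_ball G A n"
proof -
  obtain xs where xs: "set xs \<subseteq> A" "length xs \<le> n" "x = list_prod G xs"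
    using assms(3) by (rule word_ballE)
  have "inv (list_prod G xs) = list_prod G (rev (map (\<lambda>a. inv a) xs))"
    using xs(1)
  proof (induction xs)
    case (Cons a xs)
    then have "a \<in> carrier G" "set xs \<subseteq> carrier G" "set (rev (map (\<lambda>a. inv a) xs)) \<subseteq> carrier G"
      using assms(1) by auto
    then show ?case
      using Cons by (simp add: inv_mult_group list_prod_append)
  qed simp
  moreover have "set (rev (map (\<lambda>a. inv a) xs)) \<subseteq> A"
    using xs(1) assms(2) by auto
  ultimately show ?thesis
    using xs(2,3) word_ballI[of "rev (map (\<lambda>a. inv a) xs)" A n G] by simp
qed

lemma generate_subset_UN_word_ball:
  assumes "A \<subseteq> carrier G" "\<And>a. a \<in> A \<Longrightarrow> inv a \<in> A"
  shows "generate G A \<subseteq> (\<Union>n. word_ball G A n)"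
proof
  fix x assume "x \<in> generate G A"
  then show "x \<in> (\<Union>n. word_ball G A n)"
  proof induction
    case one
    then show ?case by simp
  next
    case (incl a)
    then show ?case using subset_word_ball[OF assms(1)] by blast
  next
    case (inv a)
    then show ?case using subset_word_ball[OF assms(1)] assms(2) by blast
  next
    case (eng x y)
    then show ?case using word_ball_mult[OF assms(1)] by blast
  qed
qed

lemma word_ball_subset_translates:
  assumes "U \<subseteq> carrier G" "\<one> \<in> U" "F \<subseteq> carrier G" "U <#> U \<subseteq> F <#> U"
  shows "word_ball G U n \<subseteq> word_ball G F n <#> U"
proof (induction n)
  case 0
  show ?case
    using subset_set_mult_right[OF word_ball_subset_carrier[OF assms(3)] assms(2), of 0] by simp
next
  case (Suc n)
  note F = word_ball_subset_carrier[OF assms(3)]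
  have "word_ball G U n <#> U \<subseteq> word_ball G F n <#> U <#> U"
    by (intro mono_set_mult Suc.IH subset_refl)
  also have "\<dots> = word_ball G F n <#> (U <#> U)"
    by (rule set_mult_assoc[OF F assms(1,1)])
  also have "\<dots> \<subseteq> word_ball G F n <#> (F <#> U)"
    by (intro mono_set_mult assms(4) subset_refl)
  also have "\<dots> = word_ball G F n <#> F <#> U"
    by (rule set_mult_assoc[OF F assms(3,1), symmetric])
  also have "\<dots> \<subseteq> word_ball G F (Suc n) <#> U"
    unfolding word_ball_Suc[OF assms(3)] by (intro mono_set_mult) auto
  finally have "word_ball G U n <#> U \<subseteq> word_ball G F (Suc n) <#> U" .
  moreover have "\<one> \<in> word_ball G F (Suc n) <#> U"
    using subset_set_mult_right[OF F assms(2)] one_in_word_ball by blast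
  ultimately show ?case
    by (simp add: word_ball_Suc[OF assms(1)])
qed

end

locale symmetric_generating_set = group G for G :: "('a, 'b) monoid_scheme" (structure) +
  fixes U :: "'a set"
  assumes generators_closed: "U \<subseteq> carrier G"
    and generators_inv: "u \<in> U \<Longrightarrow> inv u \<in> U"
    and generate_generators: "generate G U = carrier G"
begin

definition word_length :: "'a \<Rightarrow> nat" where
  "word_length x = (LEAST n. x \<in> word_ball G U n)"

text \<open>The junk value off the carrier is needed because \<open>Metric_space\<close> requires symmetry on the
  whole type.\<close>

definition word_dist :: "'a \<Rightarrow> 'a \<Rightarrow> real" where
  "word_dist x y =
    (if x \<in> carrier G \<and> y \<in> carrier G then real (word_length (inv x \<otimes> y)) else 0)"

lemma word_length_le_iff:
  assumes "x \<in> carrier G"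
  shows "word_length x \<le> n \<longleftrightarrow> x \<in> word_ball G U n"
proof -
  have "\<exists>n. x \<in> word_ball G U n"
    using generate_subset_UN_word_ball[OF generators_closed generators_inv] assms
    by (auto simp: generate_generators)
  then have "x \<in> word_ball G U (word_length x)"
    unfolding word_length_def by (rule LeastI_ex)
  then show ?thesis
    using word_ball_mono[of "word_length x" n U U G] unfolding word_length_def
    by (auto intro: Least_le)
qed

lemma word_length_mult:
  assumes "x \<in> carrier G" "y \<in> carrier G"
  shows "word_length (x \<otimes> y) \<le> word_length x + word_length y"
  using assms word_length_le_iff word_ball_mult[OF generators_closed]
  by (metis m_closed order_refl)

lemma word_length_inv:
  assumes "x \<in> carrier G"
  shows "word_length (inv x) = word_length x"
proof (rule antisym)
  have le: "word_length (inv y) \<le> word_length y" if "y \<in> carrier G" for y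
    using that word_length_le_iff word_ball_inv[OF generators_closed generators_inv]
    by (metis inv_closed order_refl)
  show "word_length (inv x) \<le> word_length x" "word_length x \<le> word_length (inv x)"
    using le[of x] le[of "inv x"] assms by simp_all
qed

lemma word_length_eq_0_iff: "x \<in> carrier G \<Longrightarrow> word_length x = 0 \<longleftrightarrow> x = \<one>"
  using word_length_le_iff[of x 0] by simp

sublocale word_metric: Metric_space "carrier G" word_dist
proof
  fix x y z
  show "0 \<le> word_dist x y"
    by (simp add: word_dist_def)
  show "word_dist x y = word_dist y x"
    using word_length_inv[of "inv x \<otimes> y"] by (auto simp: word_dist_def inv_mult_group)
  assume x: "x \<in> carrier G" and y: "y \<in> carrier G"
  have "inv x \<otimes> y = \<one> \<longleftrightarrow> x = y"
    using x y by (metis mult_inv_cancel l_inv r_one)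
  then show "word_dist x y = 0 \<longleftrightarrow> x = y"
    using x y by (simp add: word_dist_def word_length_eq_0_iff)
  assume z: "z \<in> carrier G"
  have "inv x \<otimes> z = (inv x \<otimes> y) \<otimes> (inv y \<otimes> z)"
    using x y z by (simp add: m_assoc)
  then show "word_dist x z \<le> word_dist x y + word_dist y z"
    using word_length_mult[of "inv x \<otimes> y" "inv y \<otimes> z"] x y z by (simp add: word_dist_def)
qed

lemma word_dist_le_iff:
  "x \<in> carrier G \<Longrightarrow> y \<in> carrier G \<Longrightarrow> word_dist x y \<le> real n \<longleftrightarrow> inv x \<otimes> y \<in> word_ball G U n"
  by (simp add: word_dist_def word_length_le_iff)

lemma word_dist_left_mult:
  assumes "g \<in> carrier G" "x \<in> carrier G" "y \<in> carrier G"
  shows "word_dist (g \<otimes> x) (g \<otimes> y) = word_dist x y"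
  using assms by (simp add: word_dist_def inv_mult_group m_assoc)

lemma mcball_one_eq_word_ball: "word_metric.mcball \<one> (real n) = word_ball G U n"
  using word_ball_subset_carrier[OF generators_closed, of n]
  by (auto simp: word_dist_le_iff subset_iff)

lemma homogeneous_word_metric: "word_metric.homogeneous"
  unfolding word_metric.homogeneous_def
proof (intro ballI)
  fix x y assume "x \<in> carrier G" "y \<in> carrier G"
  then show "\<exists>f\<in>carrier G \<rightarrow> carrier G.
      (\<forall>u\<in>carrier G. \<forall>v\<in>carrier G. word_dist (f u) (f v) = word_dist u v) \<and> f x = y"
    by (intro bexI[of _ "\<lambda>z. y \<otimes> inv x \<otimes> z"]) (auto simp: word_dist_left_mult m_assoc)
qed

lemma card_packing_le_card_word_ball:
  assumes "\<one> \<in> U" "finite F" "F \<subseteq> carrier G" "U <#> U \<subseteq> F <#> U"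
    and Q: "Q \<in> word_metric.packings 2 (word_metric.mcball \<one> (real n))"
  shows "card Q \<le> card (word_ball G F n)"
proof -
  have "Q \<subseteq> word_ball G F n <#> U"
    using Q word_ball_subset_translates[OF generators_closed assms(1,3,4), of n]
    by (auto simp: word_metric.packings_def mcball_one_eq_word_ball)
  then have "\<forall>q\<in>Q. \<exists>g\<in>word_ball G F n. \<exists>u\<in>U. q = g \<otimes> u"
    unfolding set_mult_def by blast
  then obtain h where h: "\<And>q. q \<in> Q \<Longrightarrow> h q \<in> word_ball G F n" "\<And>q. q \<in> Q \<Longrightarrow> \<exists>u\<in>U. q = h q \<otimes> u"
    by metis
  have "inj_on h Q"
  proof (rule inj_onI, rule ccontr)
    fix p q assume pq: "p \<in> Q" "q \<in> Q" "h p = h q" "p \<noteq> q"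
    then obtain u v where uv: "u \<in> U" "p = h p \<otimes> u" "v \<in> U" "q = h p \<otimes> v"
      using h(2) by metis
    have closed: "h p \<in> carrier G" "u \<in> carrier G" "v \<in> carrier G"
      using h(1)[OF pq(1)] uv generators_closed word_ball_subset_carrier[OF assms(3)] by auto
    have "inv u \<otimes> v \<in> word_ball G U (1 + 1)"
      using uv(1,3) generators_inv subset_word_ball[OF generators_closed]
      by (intro word_ball_mult[OF generators_closed]) auto
    then have "word_dist u v \<le> real 2"
      using closed by (simp only: word_dist_le_iff one_add_one)
    then have "word_dist p q \<le> 2"
      using uv(2,4) word_dist_left_mult[OF closed] by simp
    moreover have "2 < word_dist p q"
      using Q pq(1,2,4) by (simp add: word_metric.packings_def pairwise_def)
    ultimately show False by simp
  qed
  then show ?thesis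
    using h(1) finite_word_ball[OF assms(2)] by (intro card_inj_on_le) auto
qed

end

section \<open>Polynomial growth of nilpotent groups\<close>

lemma polynomial_growth_substitution:
  fixes p q :: "nat \<Rightarrow> nat"
  assumes "(\<lambda>n. real (q n)) \<in> O(\<lambda>n. real n ^ m)" "1 \<le> c" "1 \<le> k"
    and "\<And>n. 1 \<le> n \<Longrightarrow> p n \<le> q (c * n ^ k) * Suc n"
  shows "(\<lambda>n. real (p n)) \<in> O(\<lambda>n. real n ^ Suc (k * m))"
proof -
  have "n \<le> c * n ^ k" for n
    using mult_le_mono[OF assms(2) self_le_power[of n k]] assms(3) by (cases "n = 0") auto
  then have "filterlim (\<lambda>n. c * n ^ k) at_top at_top"
    by (intro filterlim_at_top_mono[OF filterlim_ident]) simp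
  then have "(\<lambda>n. real (q (c * n ^ k))) \<in> O(\<lambda>n. real (c * n ^ k) ^ m)"
    by (rule landau_o.big.compose[OF assms(1)])
  moreover have "(\<lambda>n. real (Suc n)) \<in> O(\<lambda>n. real n)"
    by (rule bigoI[of _ 2]) (auto simp: eventually_at_top_linorder)
  ultimately have "(\<lambda>n. real (q (c * n ^ k) * Suc n)) \<in> O(\<lambda>n. real (c * n ^ k) ^ m * real n)"
    unfolding of_nat_mult by (rule landau_o.big.mult)
  also have "(\<lambda>n. real (c * n ^ k) ^ m * real n) = (\<lambda>n. real c ^ m * real n ^ Suc (k * m))"
    by (simp add: power_mult_distrib ac_simps flip: power_mult)
  also have "O(\<dots>) = O(\<lambda>n. real n ^ Suc (k * m))"
    using assms(2) by (intro landau_o.big.cmult) simp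
  finally have "(\<lambda>n. real (q (c * n ^ k) * Suc n)) \<in> O(\<lambda>n. real n ^ Suc (k * m))" .
  moreover have "(\<lambda>n. real (p n)) \<in> O(\<lambda>n. real (q (c * n ^ k) * Suc n))"
    using assms(4) by (intro bigoI[of _ 1] eventually_sequentiallyI[of 1])
      (simp only: norm_of_nat of_nat_le_iff mult_1)
  ultimately show ?thesis
    by (rule landau_o.big.trans[rotated])
qed

context group
begin

definition commutator :: "'a \<Rightarrow> 'a \<Rightarrow> 'a" where
  "commutator x y = x \<otimes> y \<otimes> inv x \<otimes> inv y"

lemma commutator_closed [simp]: "x \<in> carrier G \<Longrightarrow> y \<in> carrier G \<Longrightarrow> commutator x y \<in> carrier G"
  by (simp add: commutator_def)

lemma commutator_mult_swap:
  "x \<in> carrier G \<Longrightarrow> y \<in> carrier G \<Longrightarrow> commutator x y \<otimes> (y \<otimes> x) = x \<otimes> y"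
  by (simp add: commutator_def m_assoc)

lemma inv_commutator:
  "x \<in> carrier G \<Longrightarrow> y \<in> carrier G \<Longrightarrow> inv (commutator x y) = commutator y x"
  by (simp add: commutator_def inv_mult_group m_assoc)

lemma lower_central_subgroup: "subgroup (lower_central G n) G"
proof (induction n)
  case (Suc n)
  then have "lower_central G n \<subseteq> carrier G" by (rule subgroup.subset)
  then show ?case by (auto intro!: generate_is_subgroup)
qed (simp add: subgroup_self)

lemma lower_central_Suc_subset: "lower_central G (Suc n) \<subseteq> lower_central G n"
proof (induction n)
  case 0
  then show ?case using subgroup.subset[OF lower_central_subgroup[of "Suc 0"]] by simp
next
  case (Suc n)
  then show ?case
    unfolding lower_central.simps(2)[of G "Suc n"] lower_central.simps(2)[of G n]
    by (intro mono_generate) (auto simp: lower_central.simps(2)[of G n])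
qed

lemma lower_central_antimono: "m \<le> n \<Longrightarrow> lower_central G n \<subseteq> lower_central G m"
  using lower_central_Suc_subset lift_Suc_antimono_le[of "lower_central G"] by blast

lemma commutator_in_lower_central:
  assumes "x \<in> carrier G" "y \<in> carrier G" "x \<in> lower_central G n \<or> y \<in> lower_central G n"
  shows "commutator x y \<in> lower_central G (Suc n)"
proof -
  have left: "commutator u v \<in> lower_central G (Suc n)"
    if "u \<in> lower_central G n" "v \<in> carrier G" for u v
    using that by (auto simp: commutator_def intro!: generate.incl)
  show ?thesis
    using assms(3)
  proof
    assume "y \<in> lower_central G n"
    then have "inv (commutator y x) \<in> lower_central G (Suc n)"
      using left assms(1) by (intro subgroup.m_inv_closed[OF lower_central_subgroup])
    then show ?thesis
      using assms by (simp add: inv_commutator)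
  qed (use left assms(2) in blast)
qed

text \<open>Junk for an element of all terms of the lower central series.\<close>

definition central_depth :: "'a \<Rightarrow> nat" where
  "central_depth x = (LEAST n. x \<notin> lower_central G (Suc n))"

lemma le_central_depth_iff:
  assumes "x \<in> carrier G" "x \<notin> lower_central G s"
  shows "n \<le> central_depth x \<longleftrightarrow> x \<in> lower_central G n"
proof
  assume "n \<le> central_depth x"
  then show "x \<in> lower_central G n"
  proof (cases n)
    case 0
    then show ?thesis using assms(1) by simp
  next
    case (Suc k)
    then have "k < (LEAST n. x \<notin> lower_central G (Suc n))"
      using \<open>n \<le> central_depth x\<close> by (simp add: central_depth_def)
    then show ?thesis
      using not_less_Least Suc by blast
  qed
next
  assume n: "x \<in> lower_central G n"
  have "x \<notin> lower_central G (Suc s)"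
    using assms(2) lower_central_Suc_subset by blast
  then have "x \<notin> lower_central G (Suc (central_depth x))"
    unfolding central_depth_def by (rule LeastI)
  then show "n \<le> central_depth x"
    using n lower_central_antimono[of "Suc (central_depth x)" n] by (meson not_less_eq_eq subsetD)
qed

primrec commutator_closure :: "'a set \<Rightarrow> nat \<Rightarrow> 'a set" where
  "commutator_closure F 0 = F"
| "commutator_closure F (Suc n) = commutator_closure F n \<union>
    (\<Union>x\<in>commutator_closure F n. \<Union>y\<in>commutator_closure F n. {commutator x y})"

lemma finite_commutator_closure: "finite F \<Longrightarrow> finite (commutator_closure F n)"
  by (induction n) auto

lemma commutator_closure_subset_carrier: "F \<subseteq> carrier G \<Longrightarrow> commutator_closure F n \<subseteq> carrier G"
  by (induction n) (auto simp: subset_iff)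

lemma subset_commutator_closure: "F \<subseteq> commutator_closure F n"
  by (induction n) auto

lemma commutator_closure_Suc_subset:
  assumes "F \<subseteq> carrier G"
  shows "commutator_closure F (Suc n) \<subseteq> commutator_closure F n \<union> lower_central G (Suc n)"
proof (induction n)
  case 0
  have "commutator x y \<in> lower_central G (Suc 0)" if "x \<in> F" "y \<in> F" for x y
    using that assms by (intro commutator_in_lower_central) auto
  then show ?case
    by (auto simp del: lower_central.simps)
next
  case (Suc n)
  have "commutator x y \<in> commutator_closure F (Suc n) \<union> lower_central G (Suc (Suc n))"
    if xy: "x \<in> commutator_closure F (Suc n)" "y \<in> commutator_closure F (Suc n)" for x y
  proof (cases "x \<in> commutator_closure F n \<and> y \<in> commutator_closure F n")
    case True
    then show ?thesis by auto
  next
    case False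
    with Suc xy have "x \<in> lower_central G (Suc n) \<or> y \<in> lower_central G (Suc n)" by blast
    then have "commutator x y \<in> lower_central G (Suc (Suc n))"
      using xy commutator_closure_subset_carrier[OF assms, of "Suc n"]
      by (intro commutator_in_lower_central) auto
    then show ?thesis by blast
  qed
  then show ?case
    unfolding commutator_closure.simps(2)[of F "Suc n"] by blast
qed

definition commutator_graded :: "('a \<Rightarrow> nat) \<Rightarrow> 'a set \<Rightarrow> bool" where
  "commutator_graded lev A \<longleftrightarrow> (\<forall>a\<in>A. \<forall>b\<in>A. commutator a b \<noteq> \<one> \<longrightarrow>
    commutator a b \<in> A \<and> lev a < lev (commutator a b) \<and> lev b < lev (commutator a b))"

lemma nilpotent_commutator_graded_superset:
  assumes "nilpotent_group G" "finite F" "F \<subseteq> carrier G"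
  obtains A where "finite A" "F - {\<one>} \<subseteq> A" "A \<subseteq> carrier G" "commutator_graded central_depth A"
proof -
  obtain s where s: "lower_central G s = {\<one>}"
    using assms(1) by (auto simp: nilpotent_group_def)
  define A where "A = commutator_closure F s - {\<one>}"
  have A: "finite A" "F - {\<one>} \<subseteq> A" "A \<subseteq> carrier G"
    using finite_commutator_closure[OF assms(2), of s] subset_commutator_closure[of F s]
      commutator_closure_subset_carrier[OF assms(3), of s] by (auto simp: A_def)
  have depth: "n \<le> central_depth x \<longleftrightarrow> x \<in> lower_central G n"
    if "x \<in> carrier G" "x \<noteq> \<one>" for x n
    using le_central_depth_iff[of x s] that s by simp
  have "commutator_graded central_depth A"
    unfolding commutator_graded_def
  proof (intro ballI impI conjI)
    fix a b assume ab: "a \<in> A" "b \<in> A" and ne: "commutator a b \<noteq> \<one>"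
    then have closed: "a \<in> carrier G" "b \<in> carrier G" "commutator a b \<in> carrier G"
      using A(3) by (simp_all add: subset_iff)
    have "commutator a b \<in> commutator_closure F (Suc s)"
      using ab by (auto simp: A_def)
    then show "commutator a b \<in> A"
      using commutator_closure_Suc_subset[OF assms(3), of s] lower_central_Suc_subset[of s] s ne
      unfolding A_def by blast
    have "a \<in> lower_central G (central_depth a)" "b \<in> lower_central G (central_depth b)"
      using closed ab depth[of a] depth[of b] by (auto simp: A_def)
    then show "central_depth a < central_depth (commutator a b)"
      "central_depth b < central_depth (commutator a b)"
      using closed commutator_in_lower_central depth[OF closed(3) ne] by (auto simp flip: Suc_le_eq)
  qed
  with A show ?thesis by (rule that)
qed

definition word_weight :: "('a \<Rightarrow> nat) \<Rightarrow> real \<Rightarrow> 'a list \<Rightarrow> real" where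
  "word_weight lev t xs = (\<Sum>x\<leftarrow>xs. t ^ lev x)"

lemma word_weight_simps [simp]:
  "word_weight lev t [] = 0"
  "word_weight lev t (x # xs) = t ^ lev x + word_weight lev t xs"
  by (simp_all add: word_weight_def)

lemma word_weight_nonneg: "0 \<le> t \<Longrightarrow> 0 \<le> word_weight lev t xs"
  by (induction xs) auto

lemma length_le_word_weight:
  fixes t :: real
  assumes "0 \<le> t" "t \<le> 1" "\<And>x. x \<in> set xs \<Longrightarrow> lev x \<le> s"
  shows "length xs * t ^ s \<le> word_weight lev t xs"
  using assms(3)
proof (induction xs)
  case (Cons x xs)
  then have "t ^ s \<le> t ^ lev x"
    using assms(1,2) by (intro power_decreasing) auto
  with Cons show ?case by (simp add: algebra_simps)
qed simp

lemma move_past_letter: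
  assumes "f \<in> carrier G" "a \<in> carrier G" "set ys \<subseteq> carrier G" "set zs \<subseteq> carrier G"
    and "f \<otimes> list_prod G ys = list_prod G zs \<otimes> f"
  shows "f \<otimes> list_prod G (a # ys) = commutator f a \<otimes> (list_prod G (a # zs) \<otimes> f)"
proof -
  have "f \<otimes> list_prod G (a # ys) = f \<otimes> a \<otimes> list_prod G ys"
    using assms(1-3) by (simp add: m_assoc)
  also have "\<dots> = commutator f a \<otimes> (a \<otimes> f) \<otimes> list_prod G ys"
    using assms(1,2) by (simp add: commutator_mult_swap)
  also have "\<dots> = commutator f a \<otimes> (a \<otimes> (list_prod G zs \<otimes> f))"
    using assms(1-4) by (simp add: m_assoc assms(5))
  finally show ?thesis
    using assms(1-4) by (simp add: m_assoc)
qed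

text \<open>A commutator created by moving \<open>f\<close> past a letter has a higher level than that letter. So if
  letters of level \<open>i\<close> weigh \<open>t ^ i\<close>, each move multiplies the weight of the word by at most
  \<open>1 + t\<close>, and for \<open>t = 1 / n\<close> up to \<open>n\<close> moves cost only a bounded factor.\<close>

lemma move_letter_right:
  fixes t :: real
  assumes "A \<subseteq> carrier G" "commutator_graded lev A" "f \<in> A" "0 \<le> t" "t \<le> 1"
    and "set ys \<subseteq> A - {f}"
  shows "\<exists>zs. set zs \<subseteq> A - {f} \<and> f \<otimes> list_prod G ys = list_prod G zs \<otimes> f \<and>
    word_weight lev t zs \<le> (1 + t) * word_weight lev t ys"
  using assms(6)
proof (induction ys)
  case Nil
  then show ?case using assms(1,3) by (intro exI[of _ "[]"]) auto
next
  case (Cons a ys)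
  then obtain zs where zs: "set zs \<subseteq> A - {f}" "f \<otimes> list_prod G ys = list_prod G zs \<otimes> f"
    "word_weight lev t zs \<le> (1 + t) * word_weight lev t ys"
    by auto
  have closed: "a \<in> carrier G" "f \<in> carrier G" "set ys \<subseteq> carrier G" "set zs \<subseteq> carrier G"
    using Cons.prems assms(1,3) zs(1) by auto
  have move: "f \<otimes> list_prod G (a # ys) = commutator f a \<otimes> (list_prod G (a # zs) \<otimes> f)"
    by (rule move_past_letter[OF closed(2,1,3,4) zs(2)])
  consider "commutator f a = \<one>"
    | "commutator f a \<in> A - {f}" "Suc (lev a) \<le> lev (commutator f a)"
    using assms(2,3) Cons.prems unfolding commutator_graded_def by fastforce
  then show ?case
  proof cases
    case 1
    moreover have "0 \<le> t * t ^ lev a" using assms(4) by simp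
    ultimately show ?thesis
      using move zs closed Cons.prems by (intro exI[of _ "a # zs"]) (auto simp: algebra_simps)
  next
    case 2
    then have "t ^ lev (commutator f a) \<le> t * t ^ lev a"
      using assms(4,5) power_decreasing[of "Suc (lev a)" "lev (commutator f a)" t] by simp
    then show ?thesis
      using move zs closed Cons.prems 2(1)
      by (intro exI[of _ "commutator f a # a # zs"]) (auto simp: algebra_simps m_assoc)
  qed
qed

lemma collect_next_letter:
  fixes t :: real
  assumes "A \<subseteq> carrier G" "commutator_graded lev A" "f \<in> A" "0 \<le> t" "t \<le> 1"
    and "x \<in> A" "set ys \<subseteq> A - {f}"
  shows "\<exists>zs e'. set zs \<subseteq> A - {f} \<and> e' \<le> Suc e \<and>
    x \<otimes> (list_prod G ys \<otimes> f [^] (e :: nat)) = list_prod G zs \<otimes> f [^] (e' :: nat) \<and>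
    word_weight lev t zs \<le> 1 + (1 + t) * word_weight lev t ys"
proof -
  have closed: "x \<in> carrier G" "f \<in> carrier G" "set ys \<subseteq> carrier G"
    using assms(1,3,6,7) by auto
  show ?thesis
  proof (cases "x = f")
    case True
    obtain zs where zs: "set zs \<subseteq> A - {f}" "f \<otimes> list_prod G ys = list_prod G zs \<otimes> f"
      "word_weight lev t zs \<le> (1 + t) * word_weight lev t ys"
      using move_letter_right[OF assms(1-5,7)] by blast
    have zs_closed: "set zs \<subseteq> carrier G" using zs(1) assms(1) by auto
    have "x \<otimes> (list_prod G ys \<otimes> f [^] e) = f \<otimes> list_prod G ys \<otimes> f [^] e"
      using True closed by (simp add: m_assoc)
    also have "\<dots> = list_prod G zs \<otimes> (f \<otimes> f [^] e)"
      using closed zs_closed by (simp add: zs(2) m_assoc)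
    also have "\<dots> = list_prod G zs \<otimes> f [^] Suc e"
      using closed by (simp only: nat_pow_Suc2)
    finally show ?thesis
      using zs by (intro exI[of _ zs] exI[of _ "Suc e"]) auto
  next
    case False
    have "t ^ lev x \<le> 1" "0 \<le> t * word_weight lev t ys"
      using assms(4,5) word_weight_nonneg by (auto intro: power_le_one)
    then show ?thesis
      using False assms(6,7) closed
      by (intro exI[of _ "x # ys"] exI[of _ e]) (auto simp: m_assoc algebra_simps)
  qed
qed

lemma collect_letter:
  fixes t :: real
  assumes "A \<subseteq> carrier G" "commutator_graded lev A" "f \<in> A" "0 \<le> t" "t \<le> 1" "set xs \<subseteq> A"
  shows "\<exists>ys e. set ys \<subseteq> A - {f} \<and> e \<le> length xs \<and>
    list_prod G xs = list_prod G ys \<otimes> f [^] (e :: nat) \<and>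
    word_weight lev t ys \<le> length xs * (1 + t) ^ length xs"
  using assms(6)
proof (induction xs)
  case Nil
  then show ?case by (intro exI[of _ "[]"] exI[of _ 0]) auto
next
  case (Cons x xs)
  then obtain ys e where ys: "set ys \<subseteq> A - {f}" "e \<le> length xs"
    "list_prod G xs = list_prod G ys \<otimes> f [^] (e :: nat)"
    "word_weight lev t ys \<le> length xs * (1 + t) ^ length xs"
    by auto
  obtain zs e' where zs: "set zs \<subseteq> A - {f}" "e' \<le> Suc e"
    "list_prod G (x # xs) = list_prod G zs \<otimes> f [^] (e' :: nat)"
    "word_weight lev t zs \<le> 1 + (1 + t) * word_weight lev t ys"
    using collect_next_letter[OF assms(1-5) _ ys(1), of x e] Cons.prems ys(3) by auto
  note zs(4)
  also have "1 + (1 + t) * word_weight lev t ys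
      \<le> (1 + t) ^ Suc (length xs) + (1 + t) * (length xs * (1 + t) ^ length xs)"
    using assms(4) by (intro add_mono one_le_power mult_left_mono ys(4)) auto
  also have "\<dots> = length (x # xs) * (1 + t) ^ length (x # xs)"
    by (simp add: algebra_simps)
  finally show ?case
    using zs(1-3) ys(2) by (intro exI[of _ zs] exI[of _ e']) auto
qed

lemma word_ball_subset_collected:
  assumes "A \<subseteq> carrier G" "commutator_graded lev A" "f \<in> A" "\<And>a. a \<in> A \<Longrightarrow> lev a \<le> s" "1 \<le> n"
  shows "word_ball G A n \<subseteq>
    (\<lambda>(y, e). y \<otimes> f [^] e) ` (word_ball G (A - {f}) (3 * n ^ Suc s) \<times> {0..n})"
proof
  fix x assume "x \<in> word_ball G A n"
  then obtain xs where xs: "set xs \<subseteq> A" "length xs \<le> n" "x = list_prod G xs"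
    by (rule word_ballE)
  define t where "t = 1 / real n"
  have t: "0 \<le> t" "t \<le> 1" using assms(5) by (auto simp: t_def)
  obtain ys e where ys: "set ys \<subseteq> A - {f}" "e \<le> length xs"
    "list_prod G xs = list_prod G ys \<otimes> f [^] (e :: nat)"
    "word_weight lev t ys \<le> length xs * (1 + t) ^ length xs"
    using collect_letter[OF assms(1-3) t xs(1)] by blast
  have "length ys * t ^ s \<le> word_weight lev t ys"
    using ys(1) assms(4) by (intro length_le_word_weight t) auto
  also have "\<dots> \<le> length xs * (1 + t) ^ length xs" by (rule ys)
  also have "\<dots> \<le> n * (1 + t) ^ n"
    using xs(2) t by (intro mult_mono power_increasing) auto
  also have "(1 + t) ^ n \<le> exp 1"
    using assms(5) exp_ge_one_plus_x_over_n_power_n[of n 1] by (simp add: t_def)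
  also note exp_le
  finally have "length ys * t ^ s \<le> n * 3"
    by (simp add: mult_left_mono)
  then have "real (length ys) \<le> real (3 * n ^ Suc s)"
    using assms(5) by (simp add: t_def power_divide field_simps)
  then have "list_prod G ys \<in> word_ball G (A - {f}) (3 * n ^ Suc s)"
    using ys(1) by (intro word_ballI) (simp_all only: of_nat_le_iff)
  with ys xs show "x \<in> (\<lambda>(y, e). y \<otimes> f [^] e) ` (word_ball G (A - {f}) (3 * n ^ Suc s) \<times> {0..n})"
    by force
qed

lemma card_word_ball_le_collected:
  assumes "finite A" "A \<subseteq> carrier G" "commutator_graded lev A" "f \<in> A"
    and "\<And>a. a \<in> A \<Longrightarrow> lev a \<le> s" "1 \<le> n"
  shows "card (word_ball G A n) \<le> card (word_ball G (A - {f}) (3 * n ^ Suc s)) * Suc n"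
proof -
  define pairs where "pairs = word_ball G (A - {f}) (3 * n ^ Suc s) \<times> {0..n}"
  have "finite pairs"
    using assms(1) by (simp add: pairs_def finite_word_ball)
  then have "card (word_ball G A n) \<le> card pairs"
    using word_ball_subset_collected[OF assms(2-6)] unfolding pairs_def by (rule surj_card_le)
  then show ?thesis
    by (simp add: pairs_def card_cartesian_product)
qed

lemma commutator_graded_polynomial_growth:
  assumes "finite A" "A \<subseteq> carrier G" "commutator_graded lev A"
  shows "\<exists>m. (\<lambda>n. real (card (word_ball G A n))) \<in> O(\<lambda>n. real n ^ m)"
  using assms
proof (induction A rule: finite_psubset_induct)
  case (psubset A)
  show ?case
  proof (cases "A = {}")
    case True
    then show ?thesis by (intro exI[of _ 0]) simp
  next
    case False
    obtain s where s: "\<And>a. a \<in> A \<Longrightarrow> lev a \<le> s"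
      using finite_imageI[OF psubset.hyps, of lev] by (auto simp: finite_nat_set_iff_bounded_le)
    obtain f where f: "f \<in> A" "\<And>a. a \<in> A \<Longrightarrow> lev f \<le> lev a"
      using ex_min_if_finite[of "lev ` A"] psubset.hyps False by (force simp: not_less)
    have "commutator_graded lev (A - {f})"
      using psubset.prems(2) f(2) unfolding commutator_graded_def by (fastforce simp: not_less)
    then obtain m where m: "(\<lambda>n. real (card (word_ball G (A - {f}) n))) \<in> O(\<lambda>n. real n ^ m)"
      using psubset.IH[of "A - {f}"] psubset.prems(1) f(1) by blast
    have "card (word_ball G A n) \<le> card (word_ball G (A - {f}) (3 * n ^ Suc s)) * Suc n"
      if "1 \<le> n" for n
      using that by (intro card_word_ball_le_collected[OF psubset.hyps psubset.prems f(1) s])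
    then have "(\<lambda>n. real (card (word_ball G A n))) \<in> O(\<lambda>n. real n ^ Suc (Suc s * m))"
      by (intro polynomial_growth_substitution[OF m, of 3 "Suc s"]) simp_all
    then show ?thesis by blast
  qed
qed

theorem nilpotent_polynomial_growth:
  assumes "nilpotent_group G" "finite F" "F \<subseteq> carrier G"
  shows "\<exists>m. (\<lambda>n. real (card (word_ball G F n))) \<in> O(\<lambda>n. real n ^ m)"
proof -
  obtain A where A: "finite A" "F - {\<one>} \<subseteq> A" "A \<subseteq> carrier G" "commutator_graded central_depth A"
    by (rule nilpotent_commutator_graded_superset[OF assms])
  have "word_ball G F n \<subseteq> word_ball G A n" for n
  proof
    fix x assume "x \<in> word_ball G F n"
    then obtain xs where xs: "set xs \<subseteq> F" "length xs \<le> n" "x = list_prod G xs"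
      by (rule word_ballE)
    then have "x = list_prod G (filter (\<lambda>x. x \<noteq> \<one>) xs)"
      using assms(3) by (simp add: list_prod_filter_one)
    moreover have "set (filter (\<lambda>x. x \<noteq> \<one>) xs) \<subseteq> A"
      using xs(1) A(2) by auto
    ultimately show "x \<in> word_ball G A n"
      using xs(2) by (auto intro!: word_ballI intro: order.trans[OF length_filter_le])
  qed
  then have "card (word_ball G F n) \<le> card (word_ball G A n)" for n
    by (intro card_mono finite_word_ball A(1))
  then have "(\<lambda>n. real (card (word_ball G F n))) \<in> O(\<lambda>n. real (card (word_ball G A n)))"
    by (intro bigoI[of _ 1]) simp
  then show ?thesis
    using commutator_graded_polynomial_growth[OF A(1,3,4)] by (blast intro: landau_o.big.trans)
qed

end

section \<open>Compactly generated topological groups\<close>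

lemma (in group) mem_l_coset_iff:
  assumes "g \<in> carrier G" "x \<in> carrier G" "A \<subseteq> carrier G"
  shows "x \<in> g <# A \<longleftrightarrow> inv g \<otimes> x \<in> A"
proof
  assume "x \<in> g <# A"
  then show "inv g \<otimes> x \<in> A"
    using assms by (auto simp: l_coset_def)
next
  assume "inv g \<otimes> x \<in> A"
  then have "g \<otimes> (inv g \<otimes> x) \<in> g <# A"
    unfolding l_coset_def by blast
  then show "x \<in> g <# A"
    using assms by simp
qed

lemma set_mult_eq_UN_l_coset: "A <#>\<^bsub>G\<^esub> B = (\<Union>a\<in>A. a <#\<^bsub>G\<^esub> B)"
  by (auto simp: set_mult_def l_coset_def)

lemma (in group) carrier_eq_set_mult_inv:
  assumes "subgroup P G" "K \<subseteq> carrier G" "carrier G = K <#> P"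
  shows "carrier G = P <#> (\<lambda>x. inv x) ` K"
proof (intro equalityI subsetI)
  fix g assume g: "g \<in> carrier G"
  then have "inv g \<in> K <#> P" using assms(3) inv_closed by blast
  then obtain k p where kp: "k \<in> K" "p \<in> P" "inv g = k \<otimes> p"
    by (auto simp: set_mult_def)
  then have closed: "k \<in> carrier G" "p \<in> carrier G"
    using assms(2) subgroup.subset[OF assms(1)] by auto
  have "g = inv (inv g)" using g by simp
  also have "\<dots> = inv p \<otimes> inv k" using closed by (simp add: kp(3) inv_mult_group)
  finally have "g = inv p \<otimes> inv k" .
  moreover have "inv p \<in> P"
    using subgroup.m_inv_closed[OF assms(1) kp(2)] .
  ultimately show "g \<in> P <#> (\<lambda>x. inv x) ` K"
    using kp(1) unfolding set_mult_def by blast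
next
  fix g assume "g \<in> P <#> (\<lambda>x. inv x) ` K"
  moreover have "P <#> (\<lambda>x. inv x) ` K \<subseteq> carrier G"
    using assms(2) subgroup.subset[OF assms(1)] by (intro set_mult_closed) auto
  ultimately show "g \<in> carrier G" by blast
qed

context topological_group
begin

lemma compactin_subset_carrier: "compactin T A \<Longrightarrow> A \<subseteq> carrier G"
  using compactin_subset_topspace topspace_eq_carrier by metis

lemma compactin_set_mult:
  assumes "compactin T A" "compactin T B"
  shows "compactin T (A <#> B)"
proof -
  have "A <#> B = (\<lambda>(x, y). x \<otimes> y) ` (A \<times> B)"
    by (auto simp: set_mult_def)
  then show ?thesis
    using assms image_compactin[OF _ continuous_mult] by (simp add: compactin_Times)
qed

lemma compactin_inv_image: "compactin T A \<Longrightarrow> compactin T ((\<lambda>x. inv x) ` A)"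
  by (rule image_compactin[OF _ continuous_inv])

lemma compactin_word_ball:
  assumes "compactin T A"
  shows "compactin T (word_ball G A n)"
proof (induction n)
  case 0
  then show ?case by (simp add: topspace_eq_carrier)
next
  case (Suc n)
  then have "compactin T ({\<one>} \<union> (word_ball G A n <#> A))"
    using assms by (intro compactin_Un compactin_set_mult) (simp add: topspace_eq_carrier)
  then show ?case
    using compactin_subset_carrier[OF assms] by (simp add: word_ball_Suc)
qed

lemma continuous_left_mult: "g \<in> carrier G \<Longrightarrow> continuous_map T T (\<lambda>x. g \<otimes> x)"
  using continuous_map_compose[OF continuous_map_pairedI[of T T "\<lambda>_. g" T "\<lambda>x. x"] continuous_mult]
  by (simp add: topspace_eq_carrier o_def)

lemma openin_l_coset:
  assumes "openin T W" "g \<in> carrier G"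
  shows "openin T (g <# W)"
proof -
  have "W \<subseteq> carrier G"
    using openin_subset[OF assms(1)] topspace_eq_carrier by simp
  then have "g <# W = {x \<in> topspace T. inv g \<otimes> x \<in> W}"
    using assms(2) l_coset_subset_G[of W g] mem_l_coset_iff[OF assms(2)]
    by (auto simp: topspace_eq_carrier)
  then show ?thesis
    using openin_continuous_map_preimage[OF continuous_left_mult assms(1), of "inv g"] assms(2)
    by simp
qed

lemma openin_set_mult:
  assumes "A \<subseteq> carrier G" "openin T W"
  shows "openin T (A <#> W)"
  unfolding set_mult_eq_UN_l_coset using assms openin_l_coset by (intro openin_Union) auto

lemma compactin_finite_translates:
  assumes "compactin T D" "openin T W" "A \<subseteq> carrier G" "D \<subseteq> A <#> W"
  obtains F where "finite F" "F \<subseteq> A" "D \<subseteq> F <#> W"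
proof -
  have "\<forall>V\<in>(\<lambda>a. a <# W) ` A. openin T V"
    using assms(2,3) openin_l_coset by auto
  then obtain \<F> where \<F>: "finite \<F>" "\<F> \<subseteq> (\<lambda>a. a <# W) ` A" "D \<subseteq> \<Union>\<F>"
    using assms(1,4) unfolding compactin_def set_mult_eq_UN_l_coset by meson
  obtain F where "F \<subseteq> A" "finite F" "\<F> = (\<lambda>a. a <# W) ` F"
    using finite_subset_image[OF \<F>(1,2)] by blast
  with \<F>(3) show ?thesis
    by (intro that) (auto simp: set_mult_eq_UN_l_coset)
qed

lemma compactin_subset_word_ball:
  assumes "symmetric_generating_set G U" "\<one> \<in> T interior_of U" "compactin T D"
  obtains n where "D \<subseteq> word_ball G U n"
proof -
  interpret symmetric_generating_set G U by fact
  define V where "V n = word_ball G U n <#> T interior_of U" for n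
  have "openin T (V n)" for n
    unfolding V_def by (intro openin_set_mult word_ball_subset_carrier generators_closed) simp
  moreover have "D \<subseteq> \<Union>(range V)"
  proof
    fix x assume "x \<in> D"
    then have "x \<in> generate G U"
      using compactin_subset_carrier[OF assms(3)] generate_generators by auto
    then obtain n where "x \<in> word_ball G U n"
      using generate_subset_UN_word_ball[OF generators_closed generators_inv] by blast
    then show "x \<in> \<Union>(range V)"
      using subset_set_mult_right[OF word_ball_subset_carrier[OF generators_closed] assms(2)]
      unfolding V_def by blast
  qed
  ultimately obtain \<F> where \<F>: "finite \<F>" "\<F> \<subseteq> range V" "D \<subseteq> \<Union>\<F>"
    using assms(3) unfolding compactin_def by (metis (no_types, lifting) rangeE)
  obtain N where "finite N" "\<F> = V ` N"
    using finite_subset_image[OF \<F>(1,2)] by blast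
  then obtain k where k: "\<forall>n\<in>N. n \<le> k"
    by (auto simp: finite_nat_set_iff_bounded_le)
  have "V n \<subseteq> word_ball G U (Suc k)" if "n \<in> N" for n
  proof -
    have "V n \<subseteq> word_ball G U k <#> U"
      unfolding V_def using k that by (intro mono_set_mult word_ball_mono interior_of_subset) auto
    then show ?thesis
      by (auto simp: word_ball_Suc[OF generators_closed])
  qed
  with \<F>(3) \<open>\<F> = V ` N\<close> show ?thesis
    by (intro that) blast
qed

lemma left_coarse_structureI:
  assumes "Hausdorff_space T" "compactin T D" "E \<subseteq> carrier G \<times> carrier G"
    and "\<And>x y. (x, y) \<in> E \<Longrightarrow> inv x \<otimes> y \<in> D"
  shows "E \<in> left_coarse_structure G T"
proof -
  have "(\<lambda>(x, y). inv x \<otimes> y) ` E \<subseteq> D" using assms(4) by auto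
  then have "T closure_of ((\<lambda>(x, y). inv x \<otimes> y) ` E) \<subseteq> D"
    by (rule closure_of_minimal) (rule compactin_imp_closedin[OF assms(1,2)])
  then have "compactin T (T closure_of ((\<lambda>(x, y). inv x \<otimes> y) ` E))"
    by (rule closed_compactin[OF assms(2)]) simp
  then show ?thesis using assms(3) by (simp add: left_coarse_structure_def)
qed

lemma left_coarse_structureE:
  assumes "E \<in> left_coarse_structure G T"
  obtains D where "compactin T D" "\<And>x y. (x, y) \<in> E \<Longrightarrow> inv x \<otimes> y \<in> D"
proof
  show "compactin T (T closure_of ((\<lambda>(x, y). inv x \<otimes> y) ` E))"
    using assms by (simp add: left_coarse_structure_def)
  have "(\<lambda>(x, y). inv x \<otimes> y) ` E \<subseteq> topspace T"
    using assms by (auto simp: left_coarse_structure_def topspace_eq_carrier)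
  from closure_of_subset[OF this]
  show "inv x \<otimes> y \<in> T closure_of ((\<lambda>(x, y). inv x \<otimes> y) ` E)" if "(x, y) \<in> E" for x y
    using that by (auto simp: image_subset_iff)
qed

theorem left_coarse_structure_eq_word_metric:
  assumes "Hausdorff_space T" "symmetric_generating_set G U" "compactin T U" "\<one> \<in> T interior_of U"
  shows "left_coarse_structure G T =
    Metric_space.bounded_coarse_structure (carrier G) (symmetric_generating_set.word_dist G U)"
proof -
  interpret symmetric_generating_set G U by fact
  show ?thesis
  proof (intro equalityI subsetI)
    fix E assume E: "E \<in> left_coarse_structure G T"
    then obtain D where D: "compactin T D" "\<And>x y. (x, y) \<in> E \<Longrightarrow> inv x \<otimes> y \<in> D"
      by (rule left_coarse_structureE) blast
    obtain n where n: "D \<subseteq> word_ball G U n"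
      by (rule compactin_subset_word_ball[OF assms(2,4) D(1)])
    have "E \<subseteq> carrier G \<times> carrier G"
      using E by (simp add: left_coarse_structure_def)
    moreover from this have "\<forall>(x, y)\<in>E. word_dist x y \<le> real n"
      using D(2) n word_dist_le_iff by blast
    ultimately show "E \<in> word_metric.bounded_coarse_structure"
      unfolding word_metric.bounded_coarse_structure_def by blast
  next
    fix E assume "E \<in> word_metric.bounded_coarse_structure"
    then obtain r where E: "E \<subseteq> carrier G \<times> carrier G" "\<forall>(x, y)\<in>E. word_dist x y \<le> r"
      unfolding word_metric.bounded_coarse_structure_def by blast
    obtain n where n: "r \<le> real n"
      using real_arch_simple by blast
    have "inv x \<otimes> y \<in> word_ball G U n" if "(x, y) \<in> E" for x y
    proof -
      have "x \<in> carrier G" "y \<in> carrier G" "word_dist x y \<le> r"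
        using E that by blast+
      then show ?thesis
        using n word_dist_le_iff[of x y n] by simp
    qed
    then show "E \<in> left_coarse_structure G T"
      by (rule left_coarse_structureI[OF assms(1) compactin_word_ball[OF assms(3)] E(1)])
  qed
qed

lemma compactly_generated_symmetric_generating_set:
  assumes "compactly_generated_group G T" "compactin T V"
  obtains U where "compactin T U" "V \<subseteq> U" "symmetric_generating_set G U"
proof -
  obtain C where C: "compactin T C" "generate G C = carrier G"
    using assms(1) by (auto simp: compactly_generated_group_def)
  define U where "U = C \<union> V \<union> (\<lambda>x. inv x) ` (C \<union> V)"
  have "compactin T U"
    unfolding U_def by (intro compactin_Un compactin_inv_image C(1) assms(2))
  moreover have "symmetric_generating_set G U"
  proof
    show U: "U \<subseteq> carrier G"
      by (rule compactin_subset_carrier) fact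
    show "inv u \<in> U" if "u \<in> U" for u
      using that U by (auto simp: U_def)
    have "generate G C \<subseteq> generate G U"
      by (rule mono_generate) (auto simp: U_def)
    then show "generate G U = carrier G"
      using generate_incl[OF U] C(2) by blast
  qed
  ultimately show ?thesis
    using that by (auto simp: U_def)
qed

lemma cocompact_subgroup_nbhd:
  assumes "locally_compact_space T" "cocompact_subgroup P G T"
  obtains V where "compactin T V" "\<one> \<in> T interior_of V" "carrier G \<subseteq> P <#> T interior_of V"
proof -
  obtain K where P: "subgroup P G" and K: "compactin T K" "carrier G = K <#> P"
    using assms(2) by (auto simp: cocompact_subgroup_def)
  obtain W L where W: "openin T W" "\<one> \<in> W" "W \<subseteq> L" and L: "compactin T L"
    using assms(1) one_closed unfolding locally_compact_space_def topspace_eq_carrier by metis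
  define K' where "K' = {\<one>} \<union> (\<lambda>x. inv x) ` K"
  have "compactin T K'"
    unfolding K'_def using K(1)
    by (intro compactin_Un compactin_inv_image) (simp_all add: topspace_eq_carrier)
  note K' = this compactin_subset_carrier[OF this]
  have "K' <#> W \<subseteq> K' <#> L"
    by (rule mono_set_mult[OF subset_refl W(3)])
  then have interior: "K' <#> W \<subseteq> T interior_of (K' <#> L)"
    using openin_set_mult[OF K'(2) W(1)] by (rule interior_of_maximal)
  have K'_subset: "K' \<subseteq> T interior_of (K' <#> L)"
    using subset_set_mult_right[OF K'(2) W(2)] interior by blast
  have "carrier G = P <#> (\<lambda>x. inv x) ` K"
    by (rule carrier_eq_set_mult_inv[OF P compactin_subset_carrier[OF K(1)] K(2)])
  also have "\<dots> \<subseteq> P <#> T interior_of (K' <#> L)"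
    using K'_subset by (intro mono_set_mult) (auto simp: K'_def)
  finally have "carrier G \<subseteq> P <#> T interior_of (K' <#> L)" .
  moreover have "\<one> \<in> T interior_of (K' <#> L)"
    using K'_subset by (auto simp: K'_def)
  ultimately show ?thesis
    using that[OF compactin_set_mult[OF K'(1) L]] by blast
qed

lemma cocompact_subgroup_generating_set:
  assumes "locally_compact_space T" "compactly_generated_group G T" "cocompact_subgroup P G T"
  obtains U F where "symmetric_generating_set G U" "compactin T U" "\<one> \<in> T interior_of U"
    "finite F" "F \<subseteq> P" "U <#> U \<subseteq> F <#> U"
proof -
  obtain V where V: "compactin T V" "\<one> \<in> T interior_of V" "carrier G \<subseteq> P <#> T interior_of V"
    by (rule cocompact_subgroup_nbhd[OF assms(1,3)])
  obtain U where U: "compactin T U" "V \<subseteq> U" "symmetric_generating_set G U"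
    by (rule compactly_generated_symmetric_generating_set[OF assms(2) V(1)])
  have P: "P \<subseteq> carrier G"
    using assms(3) by (auto simp: cocompact_subgroup_def dest: subgroup.subset)
  have UU: "compactin T (U <#> U)"
    by (rule compactin_set_mult[OF U(1,1)])
  then have "U <#> U \<subseteq> P <#> T interior_of V"
    using compactin_subset_carrier V(3) by blast
  then obtain F where F: "finite F" "F \<subseteq> P" "U <#> U \<subseteq> F <#> T interior_of V"
    by (rule compactin_finite_translates[OF UU openin_interior_of P])
  have "T interior_of V \<subseteq> U"
    using interior_of_subset U(2) by (rule order_trans)
  then have "F <#> T interior_of V \<subseteq> F <#> U"
    by (rule mono_set_mult[OF subset_refl])
  with F(3) have "U <#> U \<subseteq> F <#> U"
    by (rule order_trans)
  moreover have "\<one> \<in> T interior_of U"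
    using V(2) interior_of_mono[OF U(2)] by blast
  ultimately show ?thesis
    by (intro that[OF U(3,1) _ F(1,2)])
qed

theorem asdim_le_of_polynomial_growth:
  assumes "Hausdorff_space T" "symmetric_generating_set G U" "compactin T U" "\<one> \<in> T interior_of U"
    and "finite F" "F \<subseteq> carrier G" "U <#> U \<subseteq> F <#> U"
    and "(\<lambda>n. real (card (word_ball G F n))) \<in> O(\<lambda>n. real n ^ m)"
  shows "asdim G T \<le> enat (10 ^ Suc m)"
proof -
  interpret symmetric_generating_set G U by fact
  have one: "\<one> \<in> U"
    using assms(4) interior_of_subset[of T U] by blast
  have "asdim_le (carrier G) word_metric.bounded_coarse_structure (10 ^ Suc m)"
  proof (rule word_metric.asdim_le_of_polynomial_packing[OF homogeneous_word_metric one_closed])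
    show "card Q \<le> card (word_ball G F n)"
      if "Q \<in> word_metric.packings 2 (word_metric.mcball \<one> (real n))" for n Q
      by (rule card_packing_le_card_word_ball[OF one assms(5-7) that])
  qed (use assms(8) in simp_all)
  then have "coarse_asdim (carrier G) (left_coarse_structure G T) \<le> enat (10 ^ Suc m)"
    unfolding coarse_asdim_def left_coarse_structure_eq_word_metric[OF assms(1-4)]
    by (intro Inf_lower) blast
  then show ?thesis
    by (simp add: asdim_def)
qed

end

theorem theorem23:
  fixes G :: "('a, 'b) monoid_scheme" and T :: "'a topology"
  assumes "topological_group G T"
    and "Hausdorff_space T"
    and "locally_compact_space T"
    and "compactly_generated_group G T"
    and "topologically_virtually_nilpotent G T"
  shows "asdim G T < \<infinity>"
proof -
  interpret topological_group G T by fact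
  obtain P where P: "cocompact_subgroup P G T" "nilpotent_group (G\<lparr>carrier := P\<rparr>)"
    using assms(5) by (auto simp: topologically_virtually_nilpotent_def)
  obtain U F where U: "symmetric_generating_set G U" "compactin T U" "\<one>\<^bsub>G\<^esub> \<in> T interior_of U"
    and F: "finite F" "F \<subseteq> P" "U <#>\<^bsub>G\<^esub> U \<subseteq> F <#>\<^bsub>G\<^esub> U"
    by (rule cocompact_subgroup_generating_set[OF assms(3,4) P(1)])
  have subgroup: "subgroup P G"
    using P(1) by (simp add: cocompact_subgroup_def)
  then interpret P: group "G\<lparr>carrier := P\<rparr>"
    by (rule subgroup.subgroup_is_group[OF _ is_group])
  obtain m where "(\<lambda>n. real (card (word_ball G F n))) \<in> O(\<lambda>n. real n ^ m)"
    using P.nilpotent_polynomial_growth[OF P(2) F(1)] F(2) by auto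
  moreover have "F \<subseteq> carrier G"
    using F(2) subgroup.subset[OF subgroup] by blast
  ultimately have "asdim G T \<le> enat (10 ^ Suc m)"
    by (intro asdim_le_of_polynomial_growth[OF assms(2) U F(1) _ F(3)])
  also have "\<dots> < \<infinity>" by simp
  finally show ?thesis .
qed

end
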